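(* Let $n,M,N\ge 1$ be integers. Let $\hat\psi,\psi:\mathbb{R}^n\to\mathbb{R}$ be Gaussian RBF sums $$\hat\psi(x)=\sum_{i=1}^M \hat w_i\,\phi(x,\hat\mu_i,\hat\Sigma_i),\qquad \psi(x)=\sum_{i=1}^M w_i\,\phi(x,\mu_i,\Sigma_i),$$ with weights $\hat w_i,w_i\in\mathbb{R}$, means $\hat\mu_i,\mu_i\in\mathbb{R}^n$ and symmetric positive definite $\hat\Sigma_i,\Sigma_i\in\mathbb{R}^{n\times n}$, and assume that the weights $\{w_i\}_{i=1}^M$ are non-negative. Let $$A=\Big\{x\in\mathbb{R}^n \;:\; \begin{bmatrix}x\\1\end{bmatrix}^\top A_j\begin{bmatrix}x\\1\end{bmatrix}\ge 0 \text{ for all } j\in\{1,\dots,N\}\Big\}$$ be a quadratic set described by $N$ inequalities, where $A_1,\dots,A_N\in\mathbb{R}^{(n+1)\times(n+1)}$ are symmetric. Then $\hat\psi(x)\ge\psi(x)$ for all $x\in A$ if for every $i=1,\dots,M$ there exists $\tau_i=(\tau_{i,1},\dots,\tau_{i,N})\in\mathbb{R}^N$ with $\tau_{i,j}\ge 0$ for all $j$ such that the matrix $$X_i=\begin{bmatrix} Q_{\hat\Sigma_i}^{-1} & Q_{\hat\mu_i}\\ Q_{\hat\mu_i}^\top & Q_i+Q_{\mu_i,\Sigma_i}-\sum_{j=1}^N\tau_{i,j}A_j\end{bmatrix}$$ is positive semidefinite, where $$Q_i=\begin{bmatrix}\mathbf 0&\mathbf 0\\ \mathbf 0& 2\log\Big(\frac{\hat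 w_i\sqrt{|\Sigma_i|}}{w_i\sqrt{|\hat\Sigma_i|}}\Big)\end{bmatrix},\quad Q_{\hat\mu_i}=\begin{bmatrix}\mathbf 0&\mathbf 0\\ I&-\hat\mu_i\end{bmatrix},\quad Q_{\hat\Sigma_i}=\begin{bmatrix} I&\mathbf 0\\ \mathbf 0&\hat\Sigma_i^{-1}\end{bmatrix},\quad Q_{\mu_i,\Sigma_i}=\begin{bmatrix}\Sigma_i^{-1}&-\Sigma_i^{-1}\mu_i\\ -\mu_i^\top\Sigma_i^{-1}&\mu_i^\top\Sigma_i^{-1}\mu_i\end{bmatrix}.$$
   Context: For $\mu\in\mathbb{R}^n$ and a symmetric positive definite matrix $\Sigma\in\mathbb{R}^{n\times n}$, the Gaussian radial basis function (RBF) is $\phi(x,\mu,\Sigma)=\frac{1}{\sqrt{(2\pi)^n|\Sigma|}}\exp\big[-\tfrac12(x-\mu)^\top\Sigma^{-1}(x-\mu)\big]$, where $|\cdot|$ denotes the determinant. A Gaussian RBF sum is a finite linear combination $\sum_i w_i\phi(\cdot,\mu_i,\Sigma_i)$ with real weights. All matrices $Q_i,Q_{\hat\mu_i},Q_{\hat\Sigma_i},Q_{\mu_i,\Sigma_i}$ are $(n+1)\times(n+1)$. In $Q_i$ and $Q_{\mu_i,\Sigma_i}$ the block rows and block columns have sizes $n,1$; in $Q_{\hat\mu_i}$ the block rows have sizes $1,n$ and the block columns have sizes $n,1$; in $Q_{\hat\Sigma_i}$ the block rows and block columns have sizes $1,n$. $\mathbf 0$ and $I$ denote zero and identity matrices of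 the appropriate dimensions. *)

theory Defs
  imports "HOL-Analysis.Analysis"
begin

definition symmetric :: "real^'n^'n \<Rightarrow> bool" where
  "symmetric A \<longleftrightarrow> transpose A = A"

definition pos_def :: "real^'n^'n \<Rightarrow> bool" where
  "pos_def A \<longleftrightarrow> symmetric A \<and> (\<forall>x. x \<noteq> 0 \<longrightarrow> 0 < x \<bullet> (A *v x))"

definition pos_semidef :: "real^'n^'n \<Rightarrow> bool" where
  "pos_semidef A \<longleftrightarrow> symmetric A \<and> (\<forall>x. 0 \<le> x \<bullet> (A *v x))"

(* Block row and column sizes are recorded by sum types: a matrix indexed by 'a + 'b
   has its blocks of size CARD('a), CARD('b) in this order.  Beware that the all-ones
   matrix is written 1; the identity matrix is mat 1. *)
definition block_mat ::
    "real^'c^'a \<Rightarrow> real^'d^'a \<Rightarrow> real^'c^'b \<Rightarrow> real^'d^'b \<Rightarrow> real^('c + 'd)^('a + 'b)" where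
  "block_mat A B C D =
     (\<chi> i j. case i of
        Inl a \<Rightarrow> (case j of Inl c \<Rightarrow> A $ a $ c | Inr d \<Rightarrow> B $ a $ d)
      | Inr b \<Rightarrow> (case j of Inl c \<Rightarrow> C $ b $ c | Inr d \<Rightarrow> D $ b $ d))"

(* The column vector [x; 1]. *)
definition homogenize :: "real^'n \<Rightarrow> real^('n + 1)" where
  "homogenize x = (\<chi> i. case i of Inl k \<Rightarrow> x $ k | Inr _ \<Rightarrow> 1)"

definition rbf :: "real^'n \<Rightarrow> real^'n \<Rightarrow> real^'n^'n \<Rightarrow> real" where
  "rbf x \<mu> \<Sigma> =
     1 / sqrt ((2 * pi) ^ CARD('n) * det \<Sigma>)
       * exp (- (1/2) * ((x - \<mu>) \<bullet> (matrix_inv \<Sigma> *v (x - \<mu>))))"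

definition rbf_sum ::
    "nat \<Rightarrow> (nat \<Rightarrow> real) \<Rightarrow> (nat \<Rightarrow> real^'n) \<Rightarrow> (nat \<Rightarrow> real^'n^'n) \<Rightarrow> real^'n \<Rightarrow> real" where
  "rbf_sum M w \<mu> \<Sigma> x = (\<Sum>i=1..M. w i * rbf x (\<mu> i) (\<Sigma> i))"

definition quadratic_set :: "nat \<Rightarrow> (nat \<Rightarrow> real^('n + 1)^('n + 1)) \<Rightarrow> (real^'n) set" where
  "quadratic_set N A =
     {x. \<forall>j\<in>{1..N}. 0 \<le> homogenize x \<bullet> (A j *v homogenize x)}"

definition log_arg :: "real \<Rightarrow> real^'n^'n \<Rightarrow> real \<Rightarrow> real^'n^'n \<Rightarrow> real" where
  "log_arg w' \<Sigma>' w \<Sigma> = (w' * sqrt (det \<Sigma>)) / (w * sqrt (det \<Sigma>'))"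

(* Primed arguments are the hatted quantities. *)
definition Q_weight ::
    "real \<Rightarrow> real^'n^'n \<Rightarrow> real \<Rightarrow> real^'n^'n \<Rightarrow> real^('n + 1)^('n + 1)" where
  "Q_weight w' \<Sigma>' w \<Sigma> = block_mat 0 0 0 (mat (2 * ln (log_arg w' \<Sigma>' w \<Sigma>)))"

definition Q_mean :: "real^'n \<Rightarrow> real^('n + 1)^(1 + 'n)" where
  "Q_mean \<mu>' = block_mat 0 0 (mat 1) (- columnvector \<mu>')"

definition Q_cov :: "real^'n^'n \<Rightarrow> real^(1 + 'n)^(1 + 'n)" where
  "Q_cov \<Sigma>' = block_mat (mat 1) 0 0 (matrix_inv \<Sigma>')"

definition Q_mean_cov :: "real^'n \<Rightarrow> real^'n^'n \<Rightarrow> real^('n + 1)^('n + 1)" where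
  "Q_mean_cov \<mu> \<Sigma> =
     block_mat
       (matrix_inv \<Sigma>)                      (- (matrix_inv \<Sigma> ** columnvector \<mu>))
       (- (rowvector \<mu> ** matrix_inv \<Sigma>))   (rowvector \<mu> ** matrix_inv \<Sigma> ** columnvector \<mu>)"

definition X_mat ::
    "real \<Rightarrow> real^'n \<Rightarrow> real^'n^'n \<Rightarrow> real \<Rightarrow> real^'n \<Rightarrow> real^'n^'n \<Rightarrow>
     nat \<Rightarrow> (nat \<Rightarrow> real^('n + 1)^('n + 1)) \<Rightarrow> (nat \<Rightarrow> real) \<Rightarrow>
     real^((1 + 'n) + ('n + 1))^((1 + 'n) + ('n + 1))" where
  "X_mat w' \<mu>' \<Sigma>' w \<mu> \<Sigma> N A \<tau> =
     block_mat
       (matrix_inv (Q_cov \<Sigma>'))   (Q_mean \<mu>')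
       (transpose (Q_mean \<mu>'))
       (Q_weight w' \<Sigma>' w \<Sigma> + Q_mean_cov \<mu> \<Sigma> - (\<Sum>j=1..N. \<tau> j *\<^sub>R A j))"

end

theory Submission
  imports Defs
begin

text \<open>
  The inequality holds summand by summand. Write \<open>h\<close> for the homogenization of a point \<open>x\<close> of the
  quadratic set. A matrix with blocks \<open>P\<inverse>, B, B\<^sup>T, R\<close> that is positive semidefinite satisfies
  \<open>(B h) \<bullet> P (B h) \<le> h \<bullet> R h\<close>, the easy half of the Schur complement criterion
  (\<open>pos_semidef_block_schur\<close>). For \<open>X_mat\<close>, the vector \<open>B h\<close> has the blocks \<open>0\<close> and \<open>x - \<mu>'\<close>, so that the
  left side is the exponent form \<open>(x - \<mu>') \<bullet> \<Sigma>'\<inverse> (x - \<mu>')\<close> of the hatted Gaussian. On the right,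
  \<open>Q_mean_cov\<close> contributes the exponent form of the other Gaussian, \<open>Q_weight\<close> contributes
  \<open>2 ln (log_arg \<dots>)\<close>, and the multipliers \<open>\<tau>\<close> only subtract nonnegative numbers (the S-procedure). Hence

    \<open>(x - \<mu>') \<bullet> \<Sigma>'\<inverse> (x - \<mu>') \<le> 2 ln (log_arg \<dots>) + (x - \<mu>) \<bullet> \<Sigma>\<inverse> (x - \<mu>)\<close>,

  and halving and exponentiating turns this into the comparison of the two weighted Gaussians
  (\<open>weighted_rbf_le\<close>), because \<open>log_arg\<close> is the quotient of their prefactors.
\<close>

section \<open>Positive definite matrices\<close>

lemma matrix_inv_mult:
  fixes A :: "real^'n^'n"
  assumes "invertible A"
  shows "A ** matrix_inv A = mat 1" and "matrix_inv A ** A = mat 1"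
  using someI_ex[OF assms[unfolded invertible_def]] by (simp_all add: matrix_inv_def)

lemma invertible_if_trivial_kernel:
  fixes A :: "real^'n^'n"
  assumes "\<And>x. A *v x = 0 \<Longrightarrow> x = 0"
  shows "invertible A"
  using assms by (metis invertible_left_inverse matrix_left_invertible_ker)

lemma pos_def_invertible:
  fixes A :: "real^'n^'n"
  assumes "pos_def A"
  shows "invertible A"
proof (rule invertible_if_trivial_kernel)
  fix x assume "A *v x = 0"
  then show "x = 0"
    using assms unfolding pos_def_def by (metis inner_zero_right less_irrefl)
qed

text \<open>
  The segment from the identity to \<open>A\<close> consists of positive definite, hence invertible, matrices,
  so the determinant cannot change its sign along it.
\<close>

lemma pos_def_det_pos:
  fixes A :: "real^'n^'n"
  assumes A: "pos_def A"
  shows "0 < det A"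
proof (rule ccontr)
  define B where "B t = (1 - t) *\<^sub>R mat 1 + t *\<^sub>R A" for t :: real
  assume "\<not> 0 < det A"
  then have "det (B 1) \<le> 0" "0 \<le> det (B 0)"
    by (simp_all add: B_def)
  moreover have "continuous_on {0..1} (\<lambda>t. det (B t))"
    unfolding B_def det_def by (intro continuous_intros)
  ultimately obtain t where t: "0 \<le> t" "t \<le> 1" and detB: "det (B t) = 0"
    using IVT2'[of "\<lambda>t. det (B t)" 1 0 0] by auto
  have "invertible (B t)"
  proof (rule invertible_if_trivial_kernel, rule ccontr)
    fix x assume Bx: "B t *v x = 0" and "x \<noteq> 0"
    have "x \<bullet> (B t *v x) = (1 - t) * (x \<bullet> x) + t * (x \<bullet> (A *v x))"
      by (simp add: B_def matrix_vector_mult_add_rdistrib scaleR_matrix_vector_assoc[symmetric]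
          inner_add_right)
    moreover have "0 < x \<bullet> x" "0 < x \<bullet> (A *v x)"
      using A \<open>x \<noteq> 0\<close> by (auto simp: pos_def_def)
    then have "0 < (1 - t) * (x \<bullet> x) + t * (x \<bullet> (A *v x))"
      using t by (cases "t = 0") (auto intro: add_nonneg_pos)
    ultimately show False
      using Bx by simp
  qed
  with detB show False
    by (simp add: invertible_det_nz)
qed

section \<open>Block vectors and the Schur complement inequality\<close>

definition block_vec :: "real^'a \<Rightarrow> real^'b \<Rightarrow> real^('a + 'b)" where
  "block_vec a b = (\<chi> i. case i of Inl k \<Rightarrow> a $ k | Inr k \<Rightarrow> b $ k)"

lemma block_vec_nth [simp]:
  "block_vec a b $ Inl k = a $ k" "block_vec a b $ Inr l = b $ l"
  by (simp_all add: block_vec_def)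

lemma sum_UNIV_Plus:
  fixes f :: "'a::finite + 'b::finite \<Rightarrow> 'c::comm_monoid_add"
  shows "sum f UNIV = (\<Sum>k\<in>UNIV. f (Inl k)) + (\<Sum>k\<in>UNIV. f (Inr k))"
  using sum.Plus[of "UNIV :: 'a set" "UNIV :: 'b set" f] by (simp add: UNIV_Plus_UNIV)

lemma vec_eq_sum_index_iff:
  fixes v w :: "real^('a::finite + 'b::finite)"
  shows "v = w \<longleftrightarrow> (\<forall>k. v $ Inl k = w $ Inl k) \<and> (\<forall>k. v $ Inr k = w $ Inr k)"
  by (metis vec_eq_iff sum.exhaust)

lemma inner_block_vec: "block_vec a b \<bullet> block_vec c d = a \<bullet> c + b \<bullet> d"
  by (simp add: inner_vec_def sum_UNIV_Plus)

lemma block_vec_eq_0_iff: "block_vec a b = 0 \<longleftrightarrow> a = 0 \<and> b = 0"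
  by (auto simp: vec_eq_sum_index_iff vec_eq_iff)

lemma block_vec_cases:
  obtains a b where "v = block_vec a b"
proof
  show "v = block_vec (\<chi> k. v $ Inl k) (\<chi> k. v $ Inr k)"
    by (simp add: vec_eq_sum_index_iff)
qed

lemma block_mat_mult_block_vec:
  "block_mat A B C D *v block_vec a b = block_vec (A *v a + B *v b) (C *v a + D *v b)"
  by (simp add: vec_eq_sum_index_iff matrix_vector_mult_def sum_UNIV_Plus block_mat_def)

text \<open>
  The first block \<open>- P (B h)\<close> of the test vector minimizes the quadratic form when the second block
  is \<open>h\<close>; it makes the first block of the image vanish.
\<close>

lemma pos_semidef_block_schur:
  fixes P :: "real^'a^'a" and B :: "real^'b^'a" and R :: "real^'b^'b"
  assumes psd: "pos_semidef (block_mat (matrix_inv P) B (transpose B) R)"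
    and P: "invertible P"
  shows "(B *v h) \<bullet> (P *v (B *v h)) \<le> h \<bullet> (R *v h)"
proof -
  define u where "u = - (P *v (B *v h))"
  have "matrix_inv P *v u = - ((matrix_inv P ** P) *v (B *v h))"
    by (simp add: u_def matrix_vector_mul_assoc[symmetric] linear_neg[OF matrix_vector_mul_linear])
  then have "matrix_inv P *v u + B *v h = 0"
    using P by (simp add: matrix_inv_mult)
  moreover have "h \<bullet> (transpose B *v u) = (B *v h) \<bullet> u"
    by (metis dot_lmul_matrix inner_commute transpose_matrix_vector)
  moreover have "0 \<le> block_vec u h \<bullet> (block_mat (matrix_inv P) B (transpose B) R *v block_vec u h)"
    using psd by (simp add: pos_semidef_def)
  ultimately have "0 \<le> (B *v h) \<bullet> u + h \<bullet> (R *v h)"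
    by (simp add: block_mat_mult_block_vec inner_block_vec inner_add_right)
  then show ?thesis
    by (simp add: u_def)
qed

section \<open>The blocks evaluated at a homogenized vector\<close>

lemma homogenize_eq_block_vec: "homogenize x = block_vec x 1"
  by (simp add: vec_eq_sum_index_iff homogenize_def)

lemma matrix_vector_mult_minus_left: "(- A) *v x = - (A *v (x :: real^'n))"
  using matrix_vector_mult_diff_rdistrib[of 0 A x] by simp

lemma columnvector_mult_one: "columnvector v *v (1 :: real^1) = v"
  by (simp add: vec_eq_iff matrix_vector_mult_def columnvector_def)

lemma one_inner_rowvector_mult: "(1 :: real^1) \<bullet> (rowvector v *v y) = v \<bullet> y"
  by (simp add: inner_vec_def matrix_vector_mult_def rowvector_def)

lemma one_inner_mat_mult_one: "(1 :: real^1) \<bullet> (mat c *v 1) = c"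
  by (simp add: inner_vec_def matrix_vector_mult_def mat_def)

lemma Q_mean_mult_homogenize: "Q_mean \<mu> *v homogenize x = block_vec 0 (x - \<mu>)"
  by (simp add: Q_mean_def homogenize_eq_block_vec block_mat_mult_block_vec
      matrix_vector_mult_minus_left columnvector_mult_one)

lemma Q_weight_quadratic_form:
  "homogenize x \<bullet> (Q_weight w' \<Sigma>' w \<Sigma> *v homogenize x) = 2 * ln (log_arg w' \<Sigma>' w \<Sigma>)"
  by (simp add: Q_weight_def homogenize_eq_block_vec block_mat_mult_block_vec inner_block_vec
      one_inner_mat_mult_one)

lemma Q_mean_cov_quadratic_form:
  "homogenize x \<bullet> (Q_mean_cov \<mu> \<Sigma> *v homogenize x) = (x - \<mu>) \<bullet> (matrix_inv \<Sigma> *v (x - \<mu>))"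
  by (simp add: Q_mean_cov_def homogenize_eq_block_vec block_mat_mult_block_vec inner_block_vec
      matrix_vector_mult_minus_left matrix_vector_mul_assoc[symmetric] columnvector_mult_one
      inner_add_right one_inner_rowvector_mult matrix_vector_mult_diff_distrib
      inner_diff_left inner_diff_right)

lemma Q_cov_mult_block_vec: "Q_cov \<Sigma> *v block_vec a b = block_vec a (matrix_inv \<Sigma> *v b)"
  by (simp add: Q_cov_def block_mat_mult_block_vec)

lemma invertible_Q_cov:
  assumes "invertible \<Sigma>"
  shows "invertible (Q_cov \<Sigma>)"
proof (rule invertible_if_trivial_kernel)
  fix v assume v: "Q_cov \<Sigma> *v v = 0"
  obtain a b where ab: "v = block_vec a b"
    by (rule block_vec_cases)
  then have a: "a = 0" and b: "matrix_inv \<Sigma> *v b = 0"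
    using v by (simp_all add: Q_cov_mult_block_vec block_vec_eq_0_iff)
  have "b = \<Sigma> *v (matrix_inv \<Sigma> *v b)"
    using assms by (simp add: matrix_vector_mul_assoc matrix_inv_mult)
  then show "v = 0"
    using a b ab by (simp add: block_vec_eq_0_iff)
qed

text \<open>
  This is the S-procedure: on the quadratic set the terms weighted by the multipliers are
  nonnegative and can be dropped from the upper bound.
\<close>

lemma X_mat_exponent_bound:
  assumes "invertible \<Sigma>'"
    and \<tau>: "\<And>j. j \<in> {1..N} \<Longrightarrow> 0 \<le> \<tau> j"
    and psd: "pos_semidef (X_mat w' \<mu>' \<Sigma>' w \<mu> \<Sigma> N A \<tau>)"
    and x: "x \<in> quadratic_set N A"
  shows "(x - \<mu>') \<bullet> (matrix_inv \<Sigma>' *v (x - \<mu>'))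
    \<le> 2 * ln (log_arg w' \<Sigma>' w \<Sigma>) + (x - \<mu>) \<bullet> (matrix_inv \<Sigma> *v (x - \<mu>))"
proof -
  let ?h = "homogenize x"
  let ?S = "\<Sum>j=1..N. \<tau> j *\<^sub>R A j"
  have "?h \<bullet> (?S *v ?h) = (\<Sum>j=1..N. \<tau> j * (?h \<bullet> (A j *v ?h)))"
    by (induction N) (simp_all add: matrix_vector_mult_add_rdistrib inner_add_right
        scaleR_matrix_vector_assoc[symmetric])
  also have "\<dots> \<ge> 0"
    using \<tau> x by (auto simp: quadratic_set_def intro!: sum_nonneg)
  finally have "0 \<le> ?h \<bullet> (?S *v ?h)" .
  moreover have "(x - \<mu>') \<bullet> (matrix_inv \<Sigma>' *v (x - \<mu>'))
      = (Q_mean \<mu>' *v ?h) \<bullet> (Q_cov \<Sigma>' *v (Q_mean \<mu>' *v ?h))"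
    by (simp add: Q_mean_mult_homogenize Q_cov_mult_block_vec inner_block_vec)
  moreover have "\<dots> \<le> ?h \<bullet> ((Q_weight w' \<Sigma>' w \<Sigma> + Q_mean_cov \<mu> \<Sigma> - ?S) *v ?h)"
    using psd invertible_Q_cov[OF assms(1)] unfolding X_mat_def
    by (rule pos_semidef_block_schur)
  moreover have "\<dots> = 2 * ln (log_arg w' \<Sigma>' w \<Sigma>)
      + (x - \<mu>) \<bullet> (matrix_inv \<Sigma> *v (x - \<mu>)) - ?h \<bullet> (?S *v ?h)"
    by (simp add: matrix_vector_mult_diff_rdistrib matrix_vector_mult_add_rdistrib
        inner_diff_right inner_add_right Q_weight_quadratic_form Q_mean_cov_quadratic_form)
  ultimately show ?thesis
    by linarith
qed

section \<open>Comparison of weighted Gaussians\<close>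

lemma weighted_rbf_le:
  fixes x :: "real^'n"
  assumes w: "0 < w" and det: "0 < det \<Sigma>"
    and pos: "0 < log_arg w' \<Sigma>' w \<Sigma>"
    and le: "(x - \<mu>') \<bullet> (matrix_inv \<Sigma>' *v (x - \<mu>'))
      \<le> 2 * ln (log_arg w' \<Sigma>' w \<Sigma>) + (x - \<mu>) \<bullet> (matrix_inv \<Sigma> *v (x - \<mu>))"
  shows "w * rbf x \<mu> \<Sigma> \<le> w' * rbf x \<mu>' \<Sigma>'"
proof -
  let ?q' = "(x - \<mu>') \<bullet> (matrix_inv \<Sigma>' *v (x - \<mu>'))"
  let ?q = "(x - \<mu>) \<bullet> (matrix_inv \<Sigma> *v (x - \<mu>))"
  \<comment> \<open>The prefactor of \<open>w * rbf x \<mu> \<Sigma>\<close>; that of the hatted one is \<open>c\<close> times \<open>log_arg\<close>.\<close>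
  define c :: real where "c = w / (sqrt ((2 * pi) ^ CARD('n)) * sqrt (det \<Sigma>))"
  have c: "0 \<le> c"
    using w det by (simp add: c_def)
  have "exp (- (1/2) * ?q) \<le> exp (ln (log_arg w' \<Sigma>' w \<Sigma>) + - (1/2) * ?q')"
    using le by simp
  also have "\<dots> = log_arg w' \<Sigma>' w \<Sigma> * exp (- (1/2) * ?q')"
    unfolding exp_add using pos by simp
  finally have "c * exp (- (1/2) * ?q) \<le> c * (log_arg w' \<Sigma>' w \<Sigma> * exp (- (1/2) * ?q'))"
    using c by (rule mult_left_mono)
  moreover have "w * rbf x \<mu> \<Sigma> = c * exp (- (1/2) * ?q)"
    by (simp add: rbf_def c_def real_sqrt_mult)
  moreover have "w' * rbf x \<mu>' \<Sigma>' = c * (log_arg w' \<Sigma>' w \<Sigma> * exp (- (1/2) * ?q'))"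
    using w det by (simp add: rbf_def c_def log_arg_def real_sqrt_mult)
  ultimately show ?thesis
    by simp
qed

theorem lemma3:
  fixes M N :: nat
    and w' w :: "nat \<Rightarrow> real"
    and \<mu>' \<mu> :: "nat \<Rightarrow> real^'n"
    and \<Sigma>' \<Sigma> :: "nat \<Rightarrow> real^'n^'n"
    and A :: "nat \<Rightarrow> real^('n + 1)^('n + 1)"
  assumes "M \<ge> 1" and "N \<ge> 1"
    and "\<And>i. i \<in> {1..M} \<Longrightarrow> pos_def (\<Sigma>' i)"
    and "\<And>i. i \<in> {1..M} \<Longrightarrow> pos_def (\<Sigma> i)"
    and "\<And>i. i \<in> {1..M} \<Longrightarrow> 0 \<le> w i"
    and "\<And>j. j \<in> {1..N} \<Longrightarrow> symmetric (A j)"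
    \<comment> \<open>The logarithm in each X_mat is that of a positive real. This entails w i \<noteq> 0, since x / 0 = 0.\<close>
    and "\<And>i. i \<in> {1..M} \<Longrightarrow> 0 < log_arg (w' i) (\<Sigma>' i) (w i) (\<Sigma> i)"
    and "\<And>i. i \<in> {1..M} \<Longrightarrow>
           \<exists>\<tau>. (\<forall>j\<in>{1..N}. 0 \<le> \<tau> j) \<and>
               pos_semidef (X_mat (w' i) (\<mu>' i) (\<Sigma>' i) (w i) (\<mu> i) (\<Sigma> i) N A \<tau>)"
  shows "\<forall>x \<in> quadratic_set N A. rbf_sum M w' \<mu>' \<Sigma>' x \<ge> rbf_sum M w \<mu> \<Sigma> x"
proof
  fix x assume x: "x \<in> quadratic_set N A"
  show "rbf_sum M w' \<mu>' \<Sigma>' x \<ge> rbf_sum M w \<mu> \<Sigma> x"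
    unfolding rbf_sum_def
  proof (rule sum_mono)
    fix i assume i: "i \<in> {1..M}"
    obtain \<tau> where \<tau>: "\<And>j. j \<in> {1..N} \<Longrightarrow> 0 \<le> \<tau> j"
      and psd: "pos_semidef (X_mat (w' i) (\<mu>' i) (\<Sigma>' i) (w i) (\<mu> i) (\<Sigma> i) N A \<tau>)"
      using assms(8)[OF i] by blast
    \<comment> \<open>For a zero weight the fraction \<open>log_arg\<close> would have the value \<open>0\<close> of a division by zero.\<close>
    have "w i \<noteq> 0"
      using assms(7)[OF i] by (auto simp: log_arg_def)
    then have "0 < w i"
      using assms(5)[OF i] by simp
    moreover have "0 < det (\<Sigma> i)"
      using assms(4)[OF i] by (rule pos_def_det_pos)
    ultimately show "w i * rbf x (\<mu> i) (\<Sigma> i) \<le> w' i * rbf x (\<mu>' i) (\<Sigma>' i)"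
      using assms(7)[OF i]
        X_mat_exponent_bound[OF pos_def_invertible[OF assms(3)[OF i]] \<tau> psd x]
      by (rule weighted_rbf_le)
  qed
qed

end
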